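(* Let $\alpha$ be a continuous partial action of a monoid $M$ on a topological space $X$, and let $Y$ be its topological globalization. If $\alpha$ is confluent, then the canonical map $X\to Y$, $x\mapsto [e,x]$, is a topological embedding.
   Context: Partial action: a partial map $M\times X\to X$, $(u,x)\mapsto u\cdot x$, with $e\cdot x=x$ for all $x$ ($e$ the unit of $M$) and such that, whenever $v\cdot x$ is defined, $(uv)\cdot x$ is defined iff $u\cdot(v\cdot x)$ is defined, in which case they are equal. $\operatorname{dom}(u)$ is the set of $x\in X$ with $u\cdot x$ defined. The partial action is continuous if each map $u:\operatorname{dom}(u)\to X$, $x\mapsto u\cdot x$, is continuous. Globalization: $Y=(M\times X)/{\simeq}$, where $\simeq$ is the equivalence relation generated by $(uv,x)\sim(u,v\cdot x)$ whenever $v\cdot x$ is defined; $[u,x]$ is the class of $(u,x)$. $M$ acts on $Y$ by $u\cdot[v,x]=[uv,x]$. $Y$ carries the final topology with respect to all maps $X\to Y$, $x\mapsto[u,x]$, $u\in M$. Confluence: A monoid presentation $\langle G\mid R\rangle$ consists of a set $G$ and a set $R\subset G^*\times G^*$ of directed reduction rules $l\to r$ ($G^*$ is the set of finite words over $G$). It induces a one-step reduction $w_1lw_2\to w_1rw_2$ on $G^*$; the presented monoid is $G^*$ modulo the equivalence relation generated by $\to$. A word is normal if no one-step reduction applies to it; a normal form of $w$ is a normal word equivalent to $w$. The presentation is confluent if there is no infinite sequence of one-step reductions, every word has a unique normal form, and no rule has a left side consisting of a single letter. Given a presentation of $M$, one-step reduction on $G^*\times X$ is defined by $(g_n\dots g_1,x)\to(g_n\dots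 g_2,g_1\cdot x)$ whenever $g_1\cdot x$ is defined, and $(w_1,x)\to(w_2,x)$ whenever $w_1\to w_2$ in $G^*$; normality and normal forms are defined as before. The partial action is confluent if $M$ has a confluent presentation $\langle G\mid R\rangle$ such that every element of $G^*\times X$ has a unique normal form and, whenever $(g_n\dots g_1)\cdot x=y$ holds in $X$ (with $g_i\in G$), $(g_n\dots g_1,x)$ can be transformed into $((),y)$ by finitely many one-step reductions, where $()$ is the empty word. *)

theory Defs
  imports "HOL-Analysis.Abstract_Topology" "HOL-Algebra.Group"
begin

section \<open>Generated equivalence relations and normal forms\<close>

text \<open>
  The relations \<open>r\<close> used below only relate elements of the carrier \<open>A\<close>, so \<open>equivclp r\<close>
  restricted to \<open>A\<close> is the equivalence relation on \<open>A\<close> generated by \<open>r\<close>.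
\<close>

definition generated_equiv :: "'a set \<Rightarrow> ('a \<Rightarrow> 'a \<Rightarrow> bool) \<Rightarrow> 'a rel" where
  "generated_equiv A r = {(a, b). a \<in> A \<and> b \<in> A \<and> equivclp r a b}"

lemma equiv_generated_equiv: "equiv A (generated_equiv A r)"
proof (rule equivI)
  show "refl_on A (generated_equiv A r)"
    using reflp_equivclp[of r] by (auto simp: generated_equiv_def refl_on_def reflp_def)
  show "sym (generated_equiv A r)"
    by (auto simp: generated_equiv_def intro!: symI dest: equivclp_sym)
  show "trans (generated_equiv A r)"
    by (auto simp: generated_equiv_def intro!: transI dest: transpD[OF transp_equivclp])
qed (auto simp: generated_equiv_def)

definition is_normal :: "('a \<Rightarrow> 'a \<Rightarrow> bool) \<Rightarrow> 'a \<Rightarrow> bool" where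
  "is_normal r a \<longleftrightarrow> (\<nexists>b. r a b)"

definition normal_form_of :: "'a set \<Rightarrow> ('a \<Rightarrow> 'a \<Rightarrow> bool) \<Rightarrow> 'a \<Rightarrow> 'a \<Rightarrow> bool" where
  "normal_form_of A r a n \<longleftrightarrow> (a, n) \<in> generated_equiv A r \<and> is_normal r n"


section \<open>Monoid presentations\<close>

text \<open>The word \<open>g\<^sub>n \<dots> g\<^sub>1\<close> is the list \<open>[g\<^sub>n, \<dots>, g\<^sub>1]\<close>; \<open>G\<^sup>*\<close> is \<open>lists G\<close>.\<close>

inductive word_step :: "'g set \<Rightarrow> ('g list \<times> 'g list) set \<Rightarrow> 'g list \<Rightarrow> 'g list \<Rightarrow> bool"
  for G R where
  "(l, r) \<in> R \<Longrightarrow> w1 \<in> lists G \<Longrightarrow> w2 \<in> lists G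
    \<Longrightarrow> word_step G R (w1 @ l @ w2) (w1 @ r @ w2)"

definition word_equiv :: "'g set \<Rightarrow> ('g list \<times> 'g list) set \<Rightarrow> 'g list rel" where
  "word_equiv G R = generated_equiv (lists G) (word_step G R)"

definition word_class :: "'g set \<Rightarrow> ('g list \<times> 'g list) set \<Rightarrow> 'g list \<Rightarrow> 'g list set" where
  "word_class G R w = word_equiv G R `` {w}"

definition presented_monoid ::
    "'g set \<Rightarrow> ('g list \<times> 'g list) set \<Rightarrow> 'g list set monoid" where
  "presented_monoid G R =
    \<lparr>carrier = lists G // word_equiv G R,
     mult = (\<lambda>A B. \<Union>a\<in>A. \<Union>b\<in>B. word_class G R (a @ b)),
     one = word_class G R []\<rparr>"

definition confluent_presentation :: "'g set \<Rightarrow> ('g list \<times> 'g list) set \<Rightarrow> bool" where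
  "confluent_presentation G R \<longleftrightarrow>
     R \<subseteq> lists G \<times> lists G \<and>
     (\<nexists>f :: nat \<Rightarrow> 'g list. \<forall>i. word_step G R (f i) (f (Suc i))) \<and>
     (\<forall>w\<in>lists G. \<exists>!n. normal_form_of (lists G) (word_step G R) w n) \<and>
     (\<forall>(l, r)\<in>R. length l \<noteq> 1)"

lemma word_step_append:
  assumes "word_step G R a b" "c \<in> lists G" "d \<in> lists G"
  shows "word_step G R (c @ a @ d) (c @ b @ d)"
  using assms(1)
proof cases
  case (1 l r w1 w2)
  then show ?thesis
    using word_step.intros[of l r R "c @ w1" G "w2 @ d"] assms(2,3) by simp
qed

lemma equivclp_word_step_append:
  assumes "equivclp (word_step G R) a b" "c \<in> lists G" "d \<in> lists G"
  shows "equivclp (word_step G R) (c @ a @ d) (c @ b @ d)"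
  using assms(1)
proof (induction rule: equivclp_induct)
  case base
  show ?case by (simp add: equivclp_def)
next
  case (step y z)
  have "symclp (word_step G R) (c @ y @ d) (c @ z @ d)"
    using step.hyps(2) word_step_append[OF _ assms(2,3)] by (auto simp: symclp_def)
  with step.IH show ?case
    unfolding equivclp_def by (rule rtranclp.rtrancl_into_rtrancl)
qed

lemma presented_monoid_mult:
  assumes "a \<in> lists G" "b \<in> lists G"
  shows "word_class G R a \<otimes>\<^bsub>presented_monoid G R\<^esub> word_class G R b = word_class G R (a @ b)"
proof -
  have eq: "equiv (lists G) (word_equiv G R)"
    unfolding word_equiv_def by (rule equiv_generated_equiv)
  have *: "word_class G R (a' @ b') = word_class G R (a @ b)"
    if "a' \<in> word_class G R a" "b' \<in> word_class G R b" for a' b'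
  proof -
    have a': "a' \<in> lists G" "equivclp (word_step G R) a a'"
      and b': "b' \<in> lists G" "equivclp (word_step G R) b b'"
      using that by (auto simp: word_class_def word_equiv_def generated_equiv_def)
    have "equivclp (word_step G R) (a @ b) (a' @ b)"
      using equivclp_word_step_append[OF a'(2), of "[]" b] assms by simp
    moreover have "equivclp (word_step G R) (a' @ b) (a' @ b')"
      using equivclp_word_step_append[OF b'(2), of a' "[]"] a' by simp
    ultimately have "equivclp (word_step G R) (a @ b) (a' @ b')"
      using transp_equivclp[of "word_step G R"] by (blast dest: transpD)
    hence "(a @ b, a' @ b') \<in> word_equiv G R"
      using assms a'(1) b'(1) by (simp add: word_equiv_def generated_equiv_def)
    thus ?thesis
      unfolding word_class_def using equiv_class_eq[OF eq] by metis
  qed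
  have "a \<in> word_class G R a" "b \<in> word_class G R b"
    using assms equiv_class_self[OF eq] by (auto simp: word_class_def)
  with * have "(\<Union>a'\<in>word_class G R a. \<Union>b'\<in>word_class G R b. word_class G R (a' @ b'))
      = word_class G R (a @ b)"
    by blast
  thus ?thesis by (simp add: presented_monoid_def)
qed

lemma monoid_presented_monoid: "monoid (presented_monoid G R)"
proof -
  have cl: "carrier (presented_monoid G R) = word_class G R ` lists G"
    by (auto simp: presented_monoid_def quotient_def word_class_def)
  have one: "\<one>\<^bsub>presented_monoid G R\<^esub> = word_class G R []"
    by (simp add: presented_monoid_def)
  show ?thesis
    by (rule monoidI)
      (auto simp: cl one presented_monoid_mult[unfolded in_lists_conv_set] ball_Un intro!: imageI)
qed


section \<open>Partial actions\<close>

text \<open>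
  \<open>act u x = None\<close> means that \<open>u \<cdot> x\<close> is undefined. Values of \<open>act\<close> outside
  \<open>carrier M \<times> topspace X\<close> are irrelevant. The equation in the last clause is one between
  options: both sides are undefined, or both are defined and equal.
\<close>

definition partial_action ::
    "('m, 'b) monoid_scheme \<Rightarrow> 'x set \<Rightarrow> ('m \<Rightarrow> 'x \<Rightarrow> 'x option) \<Rightarrow> bool" where
  "partial_action M X act \<longleftrightarrow>
     (\<forall>u\<in>carrier M. \<forall>x\<in>X. \<forall>y. act u x = Some y \<longrightarrow> y \<in> X) \<and>
     (\<forall>x\<in>X. act \<one>\<^bsub>M\<^esub> x = Some x) \<and>
     (\<forall>u\<in>carrier M. \<forall>v\<in>carrier M. \<forall>x\<in>X. \<forall>y.
        act v x = Some y \<longrightarrow> act (u \<otimes>\<^bsub>M\<^esub> v) x = act u y)"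

definition action_dom :: "'x set \<Rightarrow> ('m \<Rightarrow> 'x \<Rightarrow> 'x option) \<Rightarrow> 'm \<Rightarrow> 'x set" where
  "action_dom X act u = {x \<in> X. act u x \<noteq> None}"

definition continuous_partial_action ::
    "('m, 'b) monoid_scheme \<Rightarrow> 'x topology \<Rightarrow> ('m \<Rightarrow> 'x \<Rightarrow> 'x option) \<Rightarrow> bool" where
  "continuous_partial_action M X act \<longleftrightarrow>
     partial_action M (topspace X) act \<and>
     (\<forall>u\<in>carrier M. continuous_map (subtopology X (action_dom (topspace X) act u)) X
        (\<lambda>x. the (act u x)))"


section \<open>Globalization\<close>

inductive glob_step ::
    "('m, 'b) monoid_scheme \<Rightarrow> 'x set \<Rightarrow> ('m \<Rightarrow> 'x \<Rightarrow> 'x option) \<Rightarrow> 'm \<times> 'x \<Rightarrow> 'm \<times> 'x \<Rightarrow> bool"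
  for M X act where
  "u \<in> carrier M \<Longrightarrow> v \<in> carrier M \<Longrightarrow> x \<in> X \<Longrightarrow> act v x = Some y \<Longrightarrow> y \<in> X
    \<Longrightarrow> glob_step M X act (u \<otimes>\<^bsub>M\<^esub> v, x) (u, y)"

definition glob_equiv ::
    "('m, 'b) monoid_scheme \<Rightarrow> 'x set \<Rightarrow> ('m \<Rightarrow> 'x \<Rightarrow> 'x option) \<Rightarrow> ('m \<times> 'x) rel" where
  "glob_equiv M X act = generated_equiv (carrier M \<times> X) (glob_step M X act)"

definition glob_class ::
    "('m, 'b) monoid_scheme \<Rightarrow> 'x set \<Rightarrow> ('m \<Rightarrow> 'x \<Rightarrow> 'x option) \<Rightarrow> 'm \<Rightarrow> 'x \<Rightarrow> ('m \<times> 'x) set" where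
  "glob_class M X act u x = glob_equiv M X act `` {(u, x)}"

definition globalization_set ::
    "('m, 'b) monoid_scheme \<Rightarrow> 'x set \<Rightarrow> ('m \<Rightarrow> 'x \<Rightarrow> 'x option) \<Rightarrow> ('m \<times> 'x) set set" where
  "globalization_set M X act = (carrier M \<times> X) // glob_equiv M X act"

text \<open>The final (finest) topology on the set \<open>Y\<close> making all \<open>f i : X \<rightarrow> Y\<close>, \<open>i \<in> I\<close>, continuous.\<close>

definition final_topology :: "'x topology \<Rightarrow> 'i set \<Rightarrow> ('i \<Rightarrow> 'x \<Rightarrow> 'y) \<Rightarrow> 'y set \<Rightarrow> 'y topology" where
  "final_topology X I f Y =
     topology (\<lambda>U. U \<subseteq> Y \<and> (\<forall>i\<in>I. openin X {x \<in> topspace X. f i x \<in> U}))"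

lemma openin_final_topology:
  "openin (final_topology X I f Y) U \<longleftrightarrow>
     U \<subseteq> Y \<and> (\<forall>i\<in>I. openin X {x \<in> topspace X. f i x \<in> U})"
proof -
  have "istopology (\<lambda>U. U \<subseteq> Y \<and> (\<forall>i\<in>I. openin X {x \<in> topspace X. f i x \<in> U}))"
    unfolding istopology_def
  proof (intro conjI allI impI ballI)
    fix S T i
    assume S: "S \<subseteq> Y \<and> (\<forall>i\<in>I. openin X {x \<in> topspace X. f i x \<in> S})"
      and T: "T \<subseteq> Y \<and> (\<forall>i\<in>I. openin X {x \<in> topspace X. f i x \<in> T})"
    show "S \<inter> T \<subseteq> Y" using S by blast
    assume "i \<in> I"
    have "{x \<in> topspace X. f i x \<in> S \<inter> T} =
        {x \<in> topspace X. f i x \<in> S} \<inter> {x \<in> topspace X. f i x \<in> T}"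
      by blast
    thus "openin X {x \<in> topspace X. f i x \<in> S \<inter> T}"
      using S T \<open>i \<in> I\<close> by (auto intro: openin_Int)
  next
    fix K i
    assume K: "\<forall>S\<in>K. S \<subseteq> Y \<and> (\<forall>i\<in>I. openin X {x \<in> topspace X. f i x \<in> S})"
    show "\<Union>K \<subseteq> Y" using K by blast
    assume "i \<in> I"
    have "{x \<in> topspace X. f i x \<in> \<Union>K} = (\<Union>S\<in>K. {x \<in> topspace X. f i x \<in> S})"
      by blast
    thus "openin X {x \<in> topspace X. f i x \<in> \<Union>K}"
      using K \<open>i \<in> I\<close> by (auto intro: openin_Union)
  qed
  thus ?thesis by (simp add: final_topology_def)
qed

lemma topspace_final_topology:
  assumes "\<And>i. i \<in> I \<Longrightarrow> f i ` topspace X \<subseteq> Y"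
  shows "topspace (final_topology X I f Y) = Y"
proof -
  have "{x \<in> topspace X. f i x \<in> Y} = topspace X" if "i \<in> I" for i
    using assms[OF that] by blast
  hence "openin (final_topology X I f Y) Y"
    by (simp add: openin_final_topology)
  thus ?thesis
    by (metis openin_final_topology openin_subset openin_topspace subset_antisym)
qed

definition globalization ::
    "('m, 'b) monoid_scheme \<Rightarrow> 'x topology \<Rightarrow> ('m \<Rightarrow> 'x \<Rightarrow> 'x option) \<Rightarrow> ('m \<times> 'x) set topology" where
  "globalization M X act =
     final_topology X (carrier M) (glob_class M (topspace X) act)
       (globalization_set M (topspace X) act)"

lemma topspace_globalization:
  "topspace (globalization M X act) = globalization_set M (topspace X) act"
  unfolding globalization_def
  by (rule topspace_final_topology)
     (auto simp: globalization_set_def glob_class_def intro: quotientI)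


section \<open>Confluent partial actions\<close>

text \<open>
  \<open>\<phi>\<close> identifies the presented monoid with \<open>M\<close>, so the element of \<open>M\<close> denoted by a word \<open>w\<close>
  is \<open>\<phi> (word_class G R w)\<close>.
\<close>

inductive action_step ::
    "'g set \<Rightarrow> ('g list \<times> 'g list) set \<Rightarrow> ('g list set \<Rightarrow> 'm) \<Rightarrow> 'x set \<Rightarrow> ('m \<Rightarrow> 'x \<Rightarrow> 'x option)
      \<Rightarrow> 'g list \<times> 'x \<Rightarrow> 'g list \<times> 'x \<Rightarrow> bool"
  for G R \<phi> X act where
  act: "w \<in> lists G \<Longrightarrow> g \<in> G \<Longrightarrow> x \<in> X \<Longrightarrow> act (\<phi> (word_class G R [g])) x = Some y
    \<Longrightarrow> action_step G R \<phi> X act (w @ [g], x) (w, y)"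
| word: "word_step G R w1 w2 \<Longrightarrow> x \<in> X \<Longrightarrow> action_step G R \<phi> X act (w1, x) (w2, x)"

text \<open>The generators are drawn from an arbitrary type, passed as the first argument.\<close>

definition confluent_partial_action ::
    "'g itself \<Rightarrow> ('m, 'b) monoid_scheme \<Rightarrow> 'x set \<Rightarrow> ('m \<Rightarrow> 'x \<Rightarrow> 'x option) \<Rightarrow> bool" where
  "confluent_partial_action (T :: 'g itself) M X act \<longleftrightarrow>
     (\<exists>(G :: 'g set) R \<phi>.
        confluent_presentation G R \<and>
        \<phi> \<in> iso (presented_monoid G R) M \<and>
        (\<forall>p\<in>lists G \<times> X. \<exists>!n. normal_form_of (lists G \<times> X) (action_step G R \<phi> X act) p n) \<and>
        (\<forall>w\<in>lists G. \<forall>x\<in>X. \<forall>y.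
           act (\<phi> (word_class G R w)) x = Some y
             \<longrightarrow> (action_step G R \<phi> X act)\<^sup>*\<^sup>* (w, x) ([], y)))"

end

theory Submission
  imports Defs
begin

text \<open>
  Two pairs identified in the globalization are connected by reductions and their inverses in \<open>G\<^sup>* \<times> X\<close> and hence
  have the same normal form; since \<open>((), x)\<close> is normal, \<open>x \<mapsto> [e, x]\<close> is injective.
  For an open \<open>U\<close>, define open sets \<open>V\<^sub>w\<close> by recursion on the word \<open>w\<close>: \<open>V\<close> of \<open>()\<close> is \<open>U\<close>,
  and \<open>V\<close> of \<open>g\<^sub>n \<dots> g\<^sub>1\<close> is the largest open set whose trace on \<open>dom(g\<^sub>1)\<close> is the preimage of \<open>V\<close> of
  \<open>g\<^sub>n \<dots> g\<^sub>2\<close> under \<open>g\<^sub>1\<close>. Because \<open>(w, x)\<close> is normal as soon as \<open>w\<close> is normal and its last letter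
  is undefined at \<open>x\<close>, the condition \<open>x \<in> V\<^sub>w\<close> for normal \<open>w\<close> only depends on the class of \<open>(w, x)\<close>.
  These classes form an open subset of the globalization whose trace on \<open>X\<close> is \<open>U\<close>.
\<close>

section \<open>Generated equivalences and normal forms\<close>

lemma equivclp_map:
  assumes "equivclp r a b" and "\<And>x y. r x y \<Longrightarrow> equivclp s (f x) (f y)"
  shows "equivclp s (f a) (f b)"
  using assms(1)
proof (induction rule: equivclp_induct)
  case base
  show ?case by (rule equivclp_refl)
next
  case (step y z)
  then have "equivclp s (f y) (f z)"
    using assms(2) equivclp_sym by metis
  with step.IH show ?case
    by (rule equivclp_trans)
qed

lemma normal_form_of_cong:
  assumes "equivclp r p q" "p \<in> A" "q \<in> A"
  shows "normal_form_of A r p n \<longleftrightarrow> normal_form_of A r q n"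
  using assms unfolding normal_form_of_def generated_equiv_def
  by (blast intro: equivclp_trans equivclp_sym)

section \<open>Open sets pulled back along partial maps\<close>

definition largest_open_preimage ::
    "'x topology \<Rightarrow> ('m \<Rightarrow> 'x \<Rightarrow> 'x option) \<Rightarrow> 'm \<Rightarrow> 'x set \<Rightarrow> 'x set" where
  "largest_open_preimage X act u S =
     \<Union>{W. openin X W \<and> (\<forall>x\<in>W. \<forall>y. act u x = Some y \<longrightarrow> y \<in> S)}"

lemma openin_largest_open_preimage: "openin X (largest_open_preimage X act u S)"
  unfolding largest_open_preimage_def by blast

text \<open>By continuity the preimage of \<open>S\<close> is relatively open in the domain of
  \<open>u\<close>, hence the trace of some open \<open>W\<close>. Points of \<open>W\<close>
  outside the domain impose no condition, so \<open>W\<close> is one of the sets in the union. The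
  domain itself need not be open.\<close>

lemma mem_largest_open_preimage_iff:
  assumes "continuous_partial_action M X act" "u \<in> carrier M" "openin X S"
    and "x \<in> topspace X" "act u x = Some y"
  shows "x \<in> largest_open_preimage X act u S \<longleftrightarrow> y \<in> S"
proof
  assume "x \<in> largest_open_preimage X act u S"
  then show "y \<in> S"
    using assms(5) by (auto simp: largest_open_preimage_def)
next
  assume "y \<in> S"
  let ?D = "action_dom (topspace X) act u"
  have "continuous_map (subtopology X ?D) X (\<lambda>x. the (act u x))"
    using assms(1,2) by (simp add: continuous_partial_action_def)
  then have "openin (subtopology X ?D)
      {z \<in> topspace (subtopology X ?D). the (act u z) \<in> S}"
    using assms(3) openin_continuous_map_preimage by blast
  then obtain W where W: "openin X W"
      "{z \<in> topspace (subtopology X ?D). the (act u z) \<in> S} = W \<inter> ?D"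
    by (auto simp: openin_subtopology)
  have "x \<in> W"
    using W(2) assms(4,5) \<open>y \<in> S\<close> by (auto simp: action_dom_def)
  moreover have "b \<in> S" if "a \<in> W" "act u a = Some b" for a b
  proof -
    have "a \<in> ?D"
      using that openin_subset[OF W(1)] by (auto simp: action_dom_def)
    with that(1) have "a \<in> {z \<in> topspace (subtopology X ?D). the (act u z) \<in> S}"
      unfolding W(2) by simp
    with that(2) show ?thesis
      by simp
  qed
  ultimately show "x \<in> largest_open_preimage X act u S"
    using W(1) unfolding largest_open_preimage_def by blast
qed

section \<open>Steps on words and on pairs\<close>

lemma action_step_append:
  assumes "action_step G R \<phi> X act (w, x) (w', x')" "c \<in> lists G"
  shows "action_step G R \<phi> X act (c @ w, x) (c @ w', x')"
  using assms(1)
proof cases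
  case (act g)
  then show ?thesis
    using action_step.act[of "c @ w'" G g x X act \<phi> R x'] assms(2) by simp
next
  case word
  then show ?thesis
    using action_step.word[of G R "c @ w" "c @ w'"] word_step_append[of G R w w' c "[]"] assms(2)
    by simp
qed

lemma is_normal_word_step_appendD:
  assumes "is_normal (word_step G R) (w @ w')" "w' \<in> lists G"
  shows "is_normal (word_step G R) w"
  unfolding is_normal_def
proof
  assume "\<exists>b. word_step G R w b"
  then obtain b where "word_step G R w b" ..
  from word_step_append[OF this, of "[]" w'] show False
    using assms by (simp add: is_normal_def)
qed

text \<open>A rule with empty left side would apply in front of every word, so no word at all could
  be normal.\<close>

lemma is_normal_Nil_word_step:
  assumes "confluent_presentation G R"
  shows "is_normal (word_step G R) []"
proof (rule ccontr)
  assume "\<not> is_normal (word_step G R) []"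
  then obtain r where r: "word_step G R [] r"
    by (auto simp: is_normal_def)
  have "[] \<in> lists G" by simp
  then obtain n where "normal_form_of (lists G) (word_step G R) [] n"
    using assms unfolding confluent_presentation_def by blast
  then have n: "n \<in> lists G" "is_normal (word_step G R) n"
    unfolding normal_form_of_def generated_equiv_def by blast+
  show False
    using word_step_append[OF r _ n(1), of "[]"] n(2) by (auto simp: is_normal_def)
qed

section \<open>Classes in the globalization\<close>

lemma glob_class_eq_iff:
  assumes "u \<in> carrier M" "x \<in> X" "v \<in> carrier M" "y \<in> X"
  shows "glob_class M X act u x = glob_class M X act v y \<longleftrightarrow>
    ((u, x), (v, y)) \<in> glob_equiv M X act"
  unfolding glob_class_def glob_equiv_def
  using assms by (intro eq_equiv_class_iff[OF equiv_generated_equiv]) auto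

lemma glob_class_in_globalization_set:
  "u \<in> carrier M \<Longrightarrow> x \<in> X \<Longrightarrow> glob_class M X act u x \<in> globalization_set M X act"
  by (auto simp: globalization_set_def glob_class_def intro: quotientI)

lemma continuous_map_glob_class:
  assumes "u \<in> carrier M"
  shows "continuous_map X (globalization M X act) (glob_class M (topspace X) act u)"
  unfolding continuous_map_def
proof (intro conjI allI impI)
  show "glob_class M (topspace X) act u \<in> topspace X \<rightarrow> topspace (globalization M X act)"
    using assms by (simp add: topspace_globalization glob_class_in_globalization_set)
  fix U assume "openin (globalization M X act) U"
  then show "openin X {x \<in> topspace X. glob_class M (topspace X) act u x \<in> U}"
    using assms by (simp add: globalization_def openin_final_topology)
qed

section \<open>Words as names of monoid elements, and identifications as reductions\<close>

locale confluent_continuous_action = monoid M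
  for M :: "('m, 'b) monoid_scheme" (structure)
    and X :: "'x topology" and act :: "'m \<Rightarrow> 'x \<Rightarrow> 'x option"
    and G :: "'g set" and R and \<phi> +
  assumes cont: "continuous_partial_action M X act"
    and presentation: "confluent_presentation G R"
    and iso: "\<phi> \<in> iso (presented_monoid G R) M"
    and unique_normal_form: "\<And>w x. w \<in> lists G \<Longrightarrow> x \<in> topspace X \<Longrightarrow>
      \<exists>!n. normal_form_of (lists G \<times> topspace X) (action_step G R \<phi> (topspace X) act) (w, x) n"
    and reduces: "\<And>w x y. w \<in> lists G \<Longrightarrow> x \<in> topspace X \<Longrightarrow>
      act (\<phi> (word_class G R w)) x = Some y \<Longrightarrow>
      (action_step G R \<phi> (topspace X) act)\<^sup>*\<^sup>* (w, x) ([], y)"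
begin

abbreviation value_of :: "'g list \<Rightarrow> 'm" where
  "value_of w \<equiv> \<phi> (word_class G R w)"

abbreviation reduction :: "'g list \<times> 'x \<Rightarrow> 'g list \<times> 'x \<Rightarrow> bool" where
  "reduction \<equiv> action_step G R \<phi> (topspace X) act"

abbreviation normal_form :: "'g list \<times> 'x \<Rightarrow> 'g list \<times> 'x \<Rightarrow> bool" where
  "normal_form \<equiv> normal_form_of (lists G \<times> topspace X) reduction"

lemma word_class_carrier: "w \<in> lists G \<Longrightarrow> word_class G R w \<in> carrier (presented_monoid G R)"
  by (simp add: presented_monoid_def word_class_def quotientI)

lemma value_of_closed: "w \<in> lists G \<Longrightarrow> value_of w \<in> carrier M"
  using iso word_class_carrier by (auto simp: iso_def hom_def)

lemma value_of_append:
  "a \<in> lists G \<Longrightarrow> b \<in> lists G \<Longrightarrow> value_of (a @ b) = value_of a \<otimes> value_of b"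
  using iso word_class_carrier
  by (simp add: iso_def hom_mult flip: presented_monoid_mult)

lemma word_class_eq_iff:
  assumes "a \<in> lists G" "b \<in> lists G"
  shows "word_class G R a = word_class G R b \<longleftrightarrow> equivclp (word_step G R) a b"
  unfolding word_class_def word_equiv_def
  using assms by (subst eq_equiv_class_iff[OF equiv_generated_equiv]) (auto simp: generated_equiv_def)

text \<open>Injectivity of \<open>\<phi>\<close> makes the two words equivalent, and word steps lift
  to pairs with a fixed point \<open>x\<close>.\<close>

lemma equivclp_reduction_if_value_of_eq:
  assumes "a \<in> lists G" "b \<in> lists G" "value_of a = value_of b" "x \<in> topspace X"
  shows "equivclp reduction (a, x) (b, x)"
proof -
  have "word_class G R a = word_class G R b"
    using iso assms word_class_carrier inj_onD unfolding iso_def bij_betw_def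
    by (metis (no_types, lifting) mem_Collect_eq)
  then have "equivclp (word_step G R) a b"
    using word_class_eq_iff assms by blast
  then show ?thesis
    by (rule equivclp_map) (auto intro: r_into_equivclp action_step.word assms)
qed

lemma obtain_normal_word:
  assumes "u \<in> carrier M"
  obtains w where "w \<in> lists G" "is_normal (word_step G R) w" "u = value_of w"
proof -
  have "u \<in> \<phi> ` carrier (presented_monoid G R)"
    using iso assms by (auto simp: iso_def bij_betw_def)
  then obtain w where w: "w \<in> lists G" "u = value_of w"
    by (auto simp: presented_monoid_def quotient_def word_class_def)
  then obtain n where "normal_form_of (lists G) (word_step G R) w n"
    using presentation unfolding confluent_presentation_def by blast
  then have "n \<in> lists G" "is_normal (word_step G R) n" "equivclp (word_step G R) w n"
    by (auto simp: normal_form_of_def generated_equiv_def)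
  with w that show thesis
    using word_class_eq_iff by metis
qed

text \<open>Membership in \<open>iso\<close> only demands that products are preserved. Since
  \<open>\<phi>\<close> is onto, some word \<open>w\<close> denotes the unit, and evaluating
  \<open>[] @ w\<close> gives the claim.\<close>

lemma value_of_Nil: "value_of [] = \<one>"
proof -
  obtain w where w: "w \<in> lists G" "\<one> = value_of w"
    using obtain_normal_word one_closed by metis
  then have "value_of [] \<otimes> \<one> = \<one>"
    using value_of_append[of "[]" w] by simp
  then show ?thesis
    using value_of_closed[of "[]"] by simp
qed

text \<open>The step has \<open>u = v \<otimes> t\<close> with \<open>t\<close> sending
  \<open>x\<close> to \<open>y\<close>. If \<open>c\<close> spells \<open>t\<close>, then
  \<open>a\<close> and \<open>b @ c\<close> denote the same element, and confluence lets
  \<open>c\<close> be absorbed into the point.\<close>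

lemma equivclp_reduction_if_glob_step:
  assumes "glob_step M (topspace X) act (u, x) (v, y)"
    and "a \<in> lists G" "u = value_of a" "b \<in> lists G" "v = value_of b"
  shows "equivclp reduction (a, x) (b, y)"
  using assms(1)
proof cases
  case (1 t)
  obtain c where c: "c \<in> lists G" "t = value_of c"
    using obtain_normal_word 1 by metis
  have "equivclp reduction (a, x) (b @ c, x)"
    using 1 assms c by (intro equivclp_reduction_if_value_of_eq) (auto simp: value_of_append)
  moreover have "equivclp reduction (c, x) ([], y)"
    using reduces c 1 by (blast intro: rtranclp_into_equivclp)
  \<comment> \<open>Letters act from the right end of the word, so putting \<open>b\<close> in front
    keeps every reduction valid.\<close>
  then have "equivclp reduction (b @ c, x) (b, y)"
    using equivclp_map[of reduction "(c, x)" "([], y)" reduction "map_prod ((@) b) id"]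
      r_into_equivclp[of reduction, OF action_step_append[OF _ assms(4)]]
    by (simp add: split_paired_all)
  ultimately show ?thesis
    by (rule equivclp_trans)
qed

lemma equivclp_reduction_if_glob_equiv:
  assumes "((u, x), (v, y)) \<in> glob_equiv M (topspace X) act"
    and "a \<in> lists G" "u = value_of a" "b \<in> lists G" "v = value_of b"
  shows "equivclp reduction (a, x) (b, y)"
proof -
  have x: "x \<in> topspace X"
    and "equivclp (glob_step M (topspace X) act) (u, x) (v, y)"
    using assms(1) by (auto simp: glob_equiv_def generated_equiv_def)
  from this(2) show ?thesis
    using assms(4,5)
  \<comment> \<open>The word \<open>b\<close> is generalized because each intermediate pair needs a
    spelling of its own. Even in the base case \<open>a\<close> and \<open>b\<close> may be
    different words for one element.\<close>
  proof (induction "(v, y)" arbitrary: v y b rule: equivclp_induct)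
    case base
    then show ?case
      using assms(2,3) x by (intro equivclp_reduction_if_value_of_eq) auto
  next
    case (step p)
    obtain v' y' where p: "p = (v', y')" by fastforce
    have "v' \<in> carrier M"
      using step.hyps(2) unfolding p by (auto elim!: glob_step.cases)
    then obtain c where c: "c \<in> lists G" "v' = value_of c"
      using obtain_normal_word by metis
    have "equivclp reduction (c, y') (b, y)"
      using step.hyps(2) step.prems c equivclp_reduction_if_glob_step equivclp_sym
      unfolding p by metis
    with step.hyps(3)[OF p c] show ?case
      by (rule equivclp_trans)
  qed
qed

section \<open>Normal pairs and the sets extending an open set\<close>

lemma normal_form_if_is_normal:
  assumes "w \<in> lists G" "x \<in> topspace X" "is_normal reduction (w, x)"
  shows "normal_form (w, x) n \<longleftrightarrow> n = (w, x)"
proof -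
  have "normal_form (w, x) (w, x)"
    using assms by (simp add: normal_form_of_def generated_equiv_def)
  then show ?thesis
    using unique_normal_form[OF assms(1,2)] by blast
qed

lemma is_normal_reduction_Nil: "is_normal reduction ([], x)"
  using is_normal_Nil_word_step[OF presentation]
  by (auto simp: is_normal_def elim: action_step.cases)

lemma is_normal_reduction_snoc:
  assumes "is_normal (word_step G R) (w @ [g])" "act (value_of [g]) x = None"
  shows "is_normal reduction (w @ [g], x)"
  using assms by (auto simp: is_normal_def elim: action_step.cases)

text \<open>\<open>fold\<close> starts at the head of the list, so the last letter, which acts first
  on a point, contributes the outermost preimage.\<close>

definition extension :: "'x set \<Rightarrow> 'g list \<Rightarrow> 'x set" where
  "extension U w = fold (\<lambda>g. largest_open_preimage X act (value_of [g])) w U"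

lemma extension_simps [simp]:
  "extension U [] = U"
  "extension U (w @ [g]) = largest_open_preimage X act (value_of [g]) (extension U w)"
  by (simp_all add: extension_def)

lemma openin_extension: "openin X U \<Longrightarrow> openin X (extension U w)"
  by (cases w rule: rev_cases) (auto simp: openin_largest_open_preimage)

text \<open>Passing to the normal form makes this an invariant of the equivalence class by
  construction.\<close>

definition normal_form_extends :: "'x set \<Rightarrow> 'g list \<times> 'x \<Rightarrow> bool" where
  "normal_form_extends U p \<longleftrightarrow> (\<exists>w x. normal_form p (w, x) \<and> x \<in> extension U w)"

lemma normal_form_extends_cong:
  assumes "equivclp reduction p q" "p \<in> lists G \<times> topspace X" "q \<in> lists G \<times> topspace X"
  shows "normal_form_extends U p \<longleftrightarrow> normal_form_extends U q"
  using normal_form_of_cong[OF assms] by (simp add: normal_form_extends_def)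

text \<open>Induction on the letter that acts first. If it is undefined at \<open>x\<close>, the
  pair is its own normal form. Otherwise one reduction leads to a pair with a shorter word, still
  normal as a prefix, and membership at \<open>x\<close> amounts to membership at the image
  point.\<close>

lemma normal_form_extends_iff:
  assumes "openin X U" "w \<in> lists G" "is_normal (word_step G R) w" "x \<in> topspace X"
  shows "normal_form_extends U (w, x) \<longleftrightarrow> x \<in> extension U w"
  using assms(2-)
proof (induction w arbitrary: x rule: rev_induct)
  case Nil
  then show ?case
    using normal_form_if_is_normal[OF _ _ is_normal_reduction_Nil]
    by (simp add: normal_form_extends_def)
next
  case (snoc g w)
  then have w: "w \<in> lists G" "g \<in> G" by auto
  show ?case
  proof (cases "act (value_of [g]) x")
    case None
    then show ?thesis
      using normal_form_if_is_normal is_normal_reduction_snoc snoc.prems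
      by (simp add: normal_form_extends_def)
  next
    case (Some y)
    have u: "value_of [g] \<in> carrier M"
      using value_of_closed w by simp
    have y: "y \<in> topspace X"
      using cont u Some snoc.prems(3)
      unfolding continuous_partial_action_def partial_action_def by blast
    have "equivclp reduction (w @ [g], x) (w, y)"
      using Some w snoc.prems by (intro r_into_equivclp action_step.act) auto
    then have "normal_form_extends U (w @ [g], x) \<longleftrightarrow> normal_form_extends U (w, y)"
      using w y snoc.prems by (intro normal_form_extends_cong) auto
    also have "\<dots> \<longleftrightarrow> y \<in> extension U w"
      using snoc.IH w y is_normal_word_step_appendD snoc.prems(2) by (metis lists.intros)
    also have "\<dots> \<longleftrightarrow> x \<in> extension U (w @ [g])"
      using mem_largest_open_preimage_iff[OF cont u openin_extension[OF assms(1)] snoc.prems(3) Some]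
      by simp
    finally show ?thesis .
  qed
qed

section \<open>The canonical map: injectivity and openness onto its image\<close>

lemma inj_on_glob_class_one: "inj_on (glob_class M (topspace X) act \<one>) (topspace X)"
proof (rule inj_onI)
  fix x y
  assume xy: "x \<in> topspace X" "y \<in> topspace X"
    and "glob_class M (topspace X) act \<one> x = glob_class M (topspace X) act \<one> y"
  then have "((\<one>, x), (\<one>, y)) \<in> glob_equiv M (topspace X) act"
    by (simp add: glob_class_eq_iff)
  then have "equivclp reduction ([], x) ([], y)"
    by (rule equivclp_reduction_if_glob_equiv) (simp_all add: value_of_Nil)
  then have "normal_form ([], x) ([], y)"
    using xy is_normal_reduction_Nil by (simp add: normal_form_of_def generated_equiv_def)
  then show "x = y"
    using normal_form_if_is_normal[OF _ xy(1) is_normal_reduction_Nil] by simp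
qed

lemma open_extension_to_globalization:
  assumes "openin X U"
  obtains V where "openin (globalization M X act) V"
    "\<And>x. x \<in> topspace X \<Longrightarrow> glob_class M (topspace X) act \<one> x \<in> V \<longleftrightarrow> x \<in> U"
proof -
  let ?c = "glob_class M (topspace X) act"
  define V where "V = {?c (value_of w) x | w x.
    w \<in> lists G \<and> x \<in> topspace X \<and> normal_form_extends U (w, x)}"
  \<comment> \<open>Equal classes come from equivalent pairs, so membership in \<open>V\<close> can
    be tested on any representative.\<close>
  have mem: "?c (value_of w) x \<in> V \<longleftrightarrow> normal_form_extends U (w, x)"
    if wx: "w \<in> lists G" "x \<in> topspace X" for w x
  proof
    assume "?c (value_of w) x \<in> V"
    then obtain w' x' where w': "w' \<in> lists G" "x' \<in> topspace X" "normal_form_extends U (w', x')"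
        "?c (value_of w) x = ?c (value_of w') x'"
      unfolding V_def by blast
    then have "equivclp reduction (w, x) (w', x')"
      using equivclp_reduction_if_glob_equiv wx by (metis glob_class_eq_iff value_of_closed)
    then show "normal_form_extends U (w, x)"
      using normal_form_extends_cong w' wx by blast
  qed (use wx in \<open>auto simp: V_def\<close>)
  have "openin X {x \<in> topspace X. ?c u x \<in> V}" if u: "u \<in> carrier M" for u
  proof -
    \<comment> \<open>A normal spelling of \<open>u\<close> is essential here: for such
      \<open>w\<close> the preimage of \<open>V\<close> is exactly the open set
      \<open>extension U w\<close>.\<close>
    obtain w where w: "w \<in> lists G" "is_normal (word_step G R) w" "u = value_of w"
      using obtain_normal_word[OF u] .
    have "{x \<in> topspace X. ?c u x \<in> V} = extension U w"
      using mem normal_form_extends_iff[OF assms] w openin_subset[OF openin_extension[OF assms]]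
      by blast
    then show ?thesis
      using openin_extension[OF assms] by simp
  qed
  moreover have "V \<subseteq> globalization_set M (topspace X) act"
    by (auto simp: V_def intro!: glob_class_in_globalization_set value_of_closed)
  ultimately have "openin (globalization M X act) V"
    by (simp add: globalization_def openin_final_topology)
  moreover have "?c \<one> x \<in> V \<longleftrightarrow> x \<in> U" if "x \<in> topspace X" for x
    using mem[of "[]" x] normal_form_extends_iff[OF assms, of "[]" x] that value_of_Nil
      is_normal_Nil_word_step[OF presentation] by simp
  ultimately show thesis
    using that by blast
qed

lemma embedding_map_glob_class_one:
  "embedding_map X (globalization M X act) (glob_class M (topspace X) act \<one>)"
proof -
  let ?f = "glob_class M (topspace X) act \<one>"
  let ?S = "subtopology (globalization M X act) (?f ` topspace X)"
  have cont_f: "continuous_map X (globalization M X act) ?f"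
    by (simp add: continuous_map_glob_class)
  have "open_map X ?S ?f"
    unfolding open_map_def
  proof (intro allI impI)
    fix U assume U: "openin X U"
    obtain V where V: "openin (globalization M X act) V"
        "\<And>x. x \<in> topspace X \<Longrightarrow> ?f x \<in> V \<longleftrightarrow> x \<in> U"
      using open_extension_to_globalization[OF U] by blast
    \<comment> \<open>Since \<open>V\<close> pulls back to \<open>U\<close>, it cuts out the image
      of \<open>U\<close> within the image of the whole space.\<close>
    have "?f ` U = V \<inter> ?f ` topspace X"
      using V(2) openin_subset[OF U] by blast
    then show "openin ?S (?f ` U)"
      using V(1) by (auto simp: openin_subtopology)
  qed
  moreover have "?f ` topspace X = topspace ?S"
    using continuous_map_image_subset_topspace[OF cont_f] by auto
  moreover have "continuous_map X ?S ?f"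
    using cont_f by (simp add: continuous_map_in_subtopology)
  ultimately show ?thesis
    unfolding embedding_map_def
    using inj_on_glob_class_one by (intro bijective_open_imp_homeomorphic_map)
qed

end

theorem corollary3p4:
  fixes M :: "('m, 'b) monoid_scheme"
    and X :: "'x topology"
    and act :: "'m \<Rightarrow> 'x \<Rightarrow> 'x option"
  assumes "monoid M"
    and "continuous_partial_action M X act"
    and "confluent_partial_action TYPE('g) M (topspace X) act"
  shows "embedding_map X (globalization M X act) (glob_class M (topspace X) act \<one>\<^bsub>M\<^esub>)"
proof -
  obtain G :: "'g set" and R \<phi> where
    "confluent_presentation G R" "\<phi> \<in> iso (presented_monoid G R) M"
    "\<forall>p\<in>lists G \<times> topspace X.
       \<exists>!n. normal_form_of (lists G \<times> topspace X) (action_step G R \<phi> (topspace X) act) p n"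
    "\<forall>w\<in>lists G. \<forall>x\<in>topspace X. \<forall>y. act (\<phi> (word_class G R w)) x = Some y \<longrightarrow>
       (action_step G R \<phi> (topspace X) act)\<^sup>*\<^sup>* (w, x) ([], y)"
    using assms(3) unfolding confluent_partial_action_def by blast
  then interpret confluent_continuous_action M X act G R \<phi>
    using assms(1,2)
    by (auto simp: confluent_continuous_action_def confluent_continuous_action_axioms_def
        simp del: in_lists_conv_set)
  show ?thesis
    by (rule embedding_map_glob_class_one)
qed

end
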